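(* Let $\mathcal F$ be an adjunction system consisting of countably many Hausdorff manifolds $M_i$ ($i\in I$, $I$ countable), in which each $A_{ij}$ is an open submanifold (open subset) of $M_i$. Then the adjunction space $\bigcup_{\mathcal F}M_i$ subordinate to $\mathcal F$ is a locally Euclidean second-countable space.
   Context: An adjunction system $\mathcal F$ indexed by a set $I$ consists of topological spaces $X_i$, subsets $A_{ij}\subseteq X_i$ (with the subspace topology) and continuous maps $f_{ij}:A_{ij}\to X_j$ such that for all $i,j,k\in I$: (A1) $A_{ii}=X_i$ and $f_{ii}=\mathrm{id}_{X_i}$; (A2) $A_{ji}=f_{ij}(A_{ij})$ and $f_{ij}^{-1}=f_{ji}$ (so $f_{ij}$ is a homeomorphism onto $A_{ji}$); (A3) for each $a\in A_{ij}\cap A_{ik}$ one has $f_{ij}(a)\in A_{jk}$ and $f_{ik}(a)=f_{jk}(f_{ij}(a))$. The adjunction space $\bigcup_{\mathcal F}X_i$ is the quotient (with the quotient topology) of the disjoint union $\bigsqcup_i X_i$ by the equivalence relation $(x,i)\cong(y,j)$ iff $x\in A_{ij}$ and $f_{ij}(x)=y$. Manifolds are locally Euclidean (every point has an open neighbourhood homeomorphic to an open subset of some $\mathbb{R}^n$), second-countable and connected; here the $M_i$ are moreover Hausdorff. *)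

theory Defs
  imports "HOL-Analysis.Analysis"
begin

(* The dimension n may depend on the point x. *)
definition locally_Euclidean_space :: "'a topology \<Rightarrow> bool" where
  "locally_Euclidean_space X \<longleftrightarrow>
     (\<forall>x \<in> topspace X. \<exists>n U V. openin X U \<and> x \<in> U \<and> openin (Euclidean_space n) V \<and>
        subtopology X U homeomorphic_space subtopology (Euclidean_space n) V)"

definition second_countable_space :: "'a topology \<Rightarrow> bool" where
  "second_countable_space X \<longleftrightarrow>
     (\<exists>\<B>. countable \<B> \<and> (\<forall>B \<in> \<B>. openin X B) \<and>
        (\<forall>U x. openin X U \<and> x \<in> U \<longrightarrow> (\<exists>B \<in> \<B>. x \<in> B \<and> B \<subseteq> U)))"

(* Manifolds need not be Hausdorff here. *)
definition topological_manifold :: "'a topology \<Rightarrow> bool" where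
  "topological_manifold X \<longleftrightarrow>
     locally_Euclidean_space X \<and> second_countable_space X \<and> connected_space X"

(* The spaces X i share one type of points but need not be related inside it:
   only pairs (i, x) enter the construction. The value of f i j outside A i j is irrelevant. *)
definition adjunction_system ::
    "'i set \<Rightarrow> ('i \<Rightarrow> 'a topology) \<Rightarrow> ('i \<Rightarrow> 'i \<Rightarrow> 'a set) \<Rightarrow> ('i \<Rightarrow> 'i \<Rightarrow> 'a \<Rightarrow> 'a) \<Rightarrow> bool" where
  "adjunction_system I X A f \<longleftrightarrow>
     (\<forall>i\<in>I. \<forall>j\<in>I. A i j \<subseteq> topspace (X i)) \<and>
     (\<forall>i\<in>I. \<forall>j\<in>I. continuous_map (subtopology (X i) (A i j)) (X j) (f i j)) \<and>
     (\<forall>i\<in>I. A i i = topspace (X i) \<and> (\<forall>x \<in> topspace (X i). f i i x = x)) \<and>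
     (\<forall>i\<in>I. \<forall>j\<in>I. A j i = f i j ` A i j \<and>
        (\<forall>x \<in> A i j. f j i (f i j x) = x) \<and> (\<forall>y \<in> A j i. f i j (f j i y) = y)) \<and>
     (\<forall>i\<in>I. \<forall>j\<in>I. \<forall>k\<in>I. \<forall>a \<in> A i j \<inter> A i k. f i j a \<in> A j k \<and> f i k a = f j k (f i j a))"

definition adjunction_rel ::
    "'i set \<Rightarrow> ('i \<Rightarrow> 'i \<Rightarrow> 'a set) \<Rightarrow> ('i \<Rightarrow> 'i \<Rightarrow> 'a \<Rightarrow> 'a) \<Rightarrow> (('i \<times> 'a) \<times> ('i \<times> 'a)) set" where
  "adjunction_rel I A f = {((i, x), (j, y)). i \<in> I \<and> j \<in> I \<and> x \<in> A i j \<and> f i j x = y}"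

definition quotient_topology :: "'a topology \<Rightarrow> ('a \<times> 'a) set \<Rightarrow> 'a set topology" where
  "quotient_topology X r =
     topology (\<lambda>U. U \<subseteq> topspace X // r \<and> openin X {x \<in> topspace X. r `` {x} \<in> U})"

definition adjunction_space ::
    "'i set \<Rightarrow> ('i \<Rightarrow> 'a topology) \<Rightarrow> ('i \<Rightarrow> 'i \<Rightarrow> 'a set) \<Rightarrow> ('i \<Rightarrow> 'i \<Rightarrow> 'a \<Rightarrow> 'a) \<Rightarrow> ('i \<times> 'a) set topology" where
  "adjunction_space I X A f = quotient_topology (sum_topology X I) (adjunction_rel I A f)"

lemma openin_quotient_topology:
  "openin (quotient_topology X r) U \<longleftrightarrow>
     U \<subseteq> topspace X // r \<and> openin X {x \<in> topspace X. r `` {x} \<in> U}"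
proof -
  have "istopology (\<lambda>U. U \<subseteq> topspace X // r \<and> openin X {x \<in> topspace X. r `` {x} \<in> U})"
    unfolding istopology_def
  proof (intro conjI allI impI)
    fix S T
    assume S: "S \<subseteq> topspace X // r \<and> openin X {x \<in> topspace X. r `` {x} \<in> S}"
      and T: "T \<subseteq> topspace X // r \<and> openin X {x \<in> topspace X. r `` {x} \<in> T}"
    have "{x \<in> topspace X. r `` {x} \<in> S \<inter> T}
        = {x \<in> topspace X. r `` {x} \<in> S} \<inter> {x \<in> topspace X. r `` {x} \<in> T}" by auto
    then show "openin X {x \<in> topspace X. r `` {x} \<in> S \<inter> T}" using S T by (simp add: openin_Int)
    show "S \<inter> T \<subseteq> topspace X // r" using S by auto
  next
    fix K
    assume K: "\<forall>U\<in>K. U \<subseteq> topspace X // r \<and> openin X {x \<in> topspace X. r `` {x} \<in> U}"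
    have "{x \<in> topspace X. r `` {x} \<in> \<Union>K} = (\<Union>U\<in>K. {x \<in> topspace X. r `` {x} \<in> U})" by auto
    then show "openin X {x \<in> topspace X. r `` {x} \<in> \<Union>K}" using K by auto
    show "\<Union>K \<subseteq> topspace X // r" using K by auto
  qed
  then show ?thesis by (simp add: quotient_topology_def topology_inverse')
qed

lemma topspace_quotient_topology: "topspace (quotient_topology X r) = topspace X // r"
proof
  show "topspace (quotient_topology X r) \<subseteq> topspace X // r"
    using openin_quotient_topology openin_topspace by blast
  have "{x \<in> topspace X. r `` {x} \<in> topspace X // r} = topspace X"
    by (auto intro: quotientI)
  then have "openin (quotient_topology X r) (topspace X // r)"
    by (simp add: openin_quotient_topology)
  then show "topspace X // r \<subseteq> topspace (quotient_topology X r)" by (rule openin_subset)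
qed

lemma quotient_map_quotient_topology:
  "quotient_map X (quotient_topology X r) (\<lambda>x. r `` {x})"
  unfolding quotient_map_def topspace_quotient_topology openin_quotient_topology
  by (auto simp: quotient_def)

lemma equiv_adjunction_rel:
  assumes "adjunction_system I X A f"
  shows "equiv (topspace (sum_topology X I)) (adjunction_rel I A f)"
proof (rule equivI)
  have sub: "\<forall>i\<in>I. \<forall>j\<in>I. A i j \<subseteq> topspace (X i)"
    and refl: "\<forall>i\<in>I. A i i = topspace (X i) \<and> (\<forall>x \<in> topspace (X i). f i i x = x)"
    and inv: "\<forall>i\<in>I. \<forall>j\<in>I. A j i = f i j ` A i j \<and>
        (\<forall>x \<in> A i j. f j i (f i j x) = x) \<and> (\<forall>y \<in> A j i. f i j (f j i y) = y)"
    and cocycle: "\<forall>i\<in>I. \<forall>j\<in>I. \<forall>k\<in>I. \<forall>a \<in> A i j \<inter> A i k.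
        f i j a \<in> A j k \<and> f i k a = f j k (f i j a)"
    using assms unfolding adjunction_system_def by - (elim conjE, assumption)+
  have img: "f i j x \<in> A j i \<and> f j i (f i j x) = x" if "i \<in> I" "j \<in> I" "x \<in> A i j" for i j x
    using inv[rule_format, OF that(1,2)] that(3) by blast
  show "adjunction_rel I A f \<subseteq> topspace (sum_topology X I) \<times> topspace (sum_topology X I)"
    unfolding adjunction_rel_def using sub img by (clarsimp, blast)
  show "refl_on (topspace (sum_topology X I)) (adjunction_rel I A f)"
    unfolding refl_on_def adjunction_rel_def using refl by clarsimp
  show "sym (adjunction_rel I A f)"
    unfolding sym_def adjunction_rel_def using img by clarsimp
  show "trans (adjunction_rel I A f)"
    unfolding trans_def adjunction_rel_def
  proof clarsimp
    fix i x j k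
    assume h: "i \<in> I" "j \<in> I" "x \<in> A i j" "k \<in> I" "f i j x \<in> A j k"
    have "f i j x \<in> A j i \<inter> A j k" using img h by blast
    then have "f j i (f i j x) \<in> A i k" using cocycle h(1,2,4) by blast
    then have "x \<in> A i k" using img h by simp
    moreover have "f i k x = f j k (f i j x)" using cocycle h \<open>x \<in> A i k\<close> by blast
    ultimately show "x \<in> A i k \<and> f i k x = f j k (f i j x)" ..
  qed
qed

end

theory Submission
  imports Defs
begin

text \<open>
  The canonical map of each \<open>M i\<close> into the adjunction space is injective because \<open>f i i\<close> is the
  identity, and open because the saturation of an open set meets each \<open>M j\<close> in a union of preimages
  under the maps \<open>f j i\<close>, whose domains are open. Hence countably many open embeddings cover the
  adjunction space; charts and countable bases are pushed forward along them.
\<close>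

lemma locally_Euclidean_space_open_embeddings:
  assumes cover: "topspace Y \<subseteq> (\<Union>i\<in>I. g i ` topspace (X i))"
    and opn: "\<And>i. i \<in> I \<Longrightarrow> open_map (X i) Y (g i)"
    and cont: "\<And>i. i \<in> I \<Longrightarrow> continuous_map (X i) Y (g i)"
    and inj: "\<And>i. i \<in> I \<Longrightarrow> inj_on (g i) (topspace (X i))"
    and loc: "\<And>i. i \<in> I \<Longrightarrow> locally_Euclidean_space (X i)"
  shows "locally_Euclidean_space Y"
  unfolding locally_Euclidean_space_def
proof
  fix y assume "y \<in> topspace Y"
  then obtain i x where i: "i \<in> I" and x: "x \<in> topspace (X i)" and y: "y = g i x"
    using cover by blast
  obtain n U V where U: "openin (X i) U" "x \<in> U" and V: "openin (Euclidean_space n) V"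
    and UV: "subtopology (X i) U homeomorphic_space subtopology (Euclidean_space n) V"
    using loc[OF i] x unfolding locally_Euclidean_space_def by blast
  \<comment> \<open>Since \<open>U\<close> is open, a set open in the subspace \<open>U\<close> is
    already open in \<open>X i\<close>.\<close>
  have "open_map (subtopology (X i) U) Y (g i)"
    using opn[OF i] U(1) openin_trans_full unfolding open_map_def by blast
  moreover have "inj_on (g i) (topspace (subtopology (X i) U))"
    using inj[OF i] by (auto intro: inj_on_subset)
  ultimately have "embedding_map (subtopology (X i) U) Y (g i)"
    by (intro injective_open_imp_embedding_map continuous_map_from_subtopology cont[OF i])
  then have "subtopology (X i) U homeomorphic_space subtopology Y (g i ` U)"
    using embedding_map_imp_homeomorphic_space topspace_subtopology_subset[OF openin_subset[OF U(1)]]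
    by metis
  then have "subtopology Y (g i ` U) homeomorphic_space subtopology (Euclidean_space n) V"
    using UV homeomorphic_space_sym homeomorphic_space_trans by blast
  moreover have "openin Y (g i ` U)"
    using opn[OF i] U(1) by (simp add: open_map_def)
  ultimately show "\<exists>n U V. openin Y U \<and> y \<in> U \<and> openin (Euclidean_space n) V \<and>
      subtopology Y U homeomorphic_space subtopology (Euclidean_space n) V"
    using U(2) V y by blast
qed

text \<open>The images of basic sets form a countable basis of \<open>Y\<close>: openness of
  \<open>g i\<close> makes them open, and continuity makes them small enough.\<close>

lemma second_countable_space_open_maps:
  assumes "countable I"
    and cover: "topspace Y \<subseteq> (\<Union>i\<in>I. g i ` topspace (X i))"
    and opn: "\<And>i. i \<in> I \<Longrightarrow> open_map (X i) Y (g i)"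
    and cont: "\<And>i. i \<in> I \<Longrightarrow> continuous_map (X i) Y (g i)"
    and sec: "\<And>i. i \<in> I \<Longrightarrow> second_countable_space (X i)"
  shows "second_countable_space Y"
proof -
  have "\<forall>i\<in>I. \<exists>\<B>. countable \<B> \<and> (\<forall>B \<in> \<B>. openin (X i) B) \<and>
        (\<forall>U x. openin (X i) U \<and> x \<in> U \<longrightarrow> (\<exists>B \<in> \<B>. x \<in> B \<and> B \<subseteq> U))"
    using sec unfolding second_countable_space_def by blast
  from bchoice[OF this] obtain \<B> where *: "\<forall>i\<in>I. countable (\<B> i) \<and> (\<forall>B \<in> \<B> i. openin (X i) B) \<and>
        (\<forall>U x. openin (X i) U \<and> x \<in> U \<longrightarrow> (\<exists>B \<in> \<B> i. x \<in> B \<and> B \<subseteq> U))"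
    by blast
  have \<B>: "countable (\<B> i)" "\<forall>B \<in> \<B> i. openin (X i) B"
    "\<And>U x. openin (X i) U \<Longrightarrow> x \<in> U \<Longrightarrow> \<exists>B \<in> \<B> i. x \<in> B \<and> B \<subseteq> U" if "i \<in> I" for i
    using *[rule_format, OF that] by simp_all
  have "\<exists>B \<in> (\<Union>i\<in>I. (`) (g i) ` \<B> i). y \<in> B \<and> B \<subseteq> U" if U: "openin Y U" "y \<in> U" for U y
  proof -
    obtain i x where i: "i \<in> I" and x: "x \<in> topspace (X i)" and y: "y = g i x"
      using cover U openin_subset by blast
    \<comment> \<open>A basic set around \<open>x\<close> inside the preimage of \<open>U\<close>
      has an image that contains \<open>y\<close> and stays in \<open>U\<close>.\<close>
    have "openin (X i) {x \<in> topspace (X i). g i x \<in> U}"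
      using openin_continuous_map_preimage[OF cont[OF i] U(1)] .
    then obtain B where "B \<in> \<B> i" "x \<in> B" "B \<subseteq> {x \<in> topspace (X i). g i x \<in> U}"
      using \<B>(3)[OF i] x y U(2) by blast
    then show ?thesis using i y by blast
  qed
  moreover have "countable (\<Union>i\<in>I. (`) (g i) ` \<B> i)"
    using \<open>countable I\<close> \<B>(1) by blast
  moreover have "\<forall>B \<in> (\<Union>i\<in>I. (`) (g i) ` \<B> i). openin Y B"
    using opn \<B>(2) by (auto simp: open_map_def)
  ultimately show ?thesis unfolding second_countable_space_def
    by (intro exI[of _ "\<Union>i\<in>I. (`) (g i) ` \<B> i"] conjI) simp_all
qed

context
  fixes I :: "'i set" and X :: "'i \<Rightarrow> 'a topology" and A :: "'i \<Rightarrow> 'i \<Rightarrow> 'a set"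
    and f :: "'i \<Rightarrow> 'i \<Rightarrow> 'a \<Rightarrow> 'a"
  assumes sys: "adjunction_system I X A f"
begin

text \<open>Every class has a representative \<open>(i, x)\<close>; this supplies the covering
  hypothesis of both transfer lemmas.\<close>

lemma topspace_adjunction_space:
  "topspace (adjunction_space I X A f) = (\<Union>i\<in>I. (\<lambda>x. adjunction_rel I A f `` {(i, x)}) ` topspace (X i))"
  unfolding adjunction_space_def topspace_quotient_topology by (fastforce simp: quotient_def)

text \<open>The canonical map is the inclusion of a summand followed by the quotient map.\<close>

lemma continuous_map_adjunction_space:
  assumes "i \<in> I"
  shows "continuous_map (X i) (adjunction_space I X A f) (\<lambda>x. adjunction_rel I A f `` {(i, x)})"
  using continuous_map_compose[OF continuous_map_component_injection[OF assms, of X]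
      quotient_imp_continuous_map[OF quotient_map_quotient_topology[of _ "adjunction_rel I A f"]]]
  by (simp add: adjunction_space_def comp_def)

text \<open>Classes of an equivalence relation agree exactly when their representatives are related.
  Injectivity and openness of the canonical maps both reduce to this criterion.\<close>

lemma adjunction_class_eq_iff:
  assumes "i \<in> I" "j \<in> I" "x \<in> topspace (X i)" "y \<in> topspace (X j)"
  shows "adjunction_rel I A f `` {(i, x)} = adjunction_rel I A f `` {(j, y)} \<longleftrightarrow> x \<in> A i j \<and> f i j x = y"
  using eq_equiv_class_iff[OF equiv_adjunction_rel[OF sys], of "(i, x)" "(j, y)"] assms
  by (simp add: adjunction_rel_def)

lemma inj_on_adjunction_space:
  assumes "i \<in> I"
  shows "inj_on (\<lambda>x. adjunction_rel I A f `` {(i, x)}) (topspace (X i))"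
  \<comment> \<open>The selected conjunct is (A1): with \<open>j = i\<close>, equality of classes
    becomes \<open>f i i x = y\<close>, that is, \<open>x = y\<close>.\<close>
  using sys[unfolded adjunction_system_def, THEN conjunct2, THEN conjunct2, THEN conjunct1] assms
  by (auto simp: inj_on_def adjunction_class_eq_iff)

lemma open_map_adjunction_space:
  assumes opn: "\<And>i j. i \<in> I \<Longrightarrow> j \<in> I \<Longrightarrow> openin (X i) (A i j)" and i: "i \<in> I"
  shows "open_map (X i) (adjunction_space I X A f) (\<lambda>x. adjunction_rel I A f `` {(i, x)})"
  unfolding open_map_def
proof (intro allI impI)
  fix W assume W: "openin (X i) W"
  then have sub: "W \<subseteq> topspace (X i)" by (rule openin_subset)
  let ?q = "\<lambda>x. adjunction_rel I A f `` {x}"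
  let ?W = "(\<lambda>x. ?q (i, x)) ` W"
  \<comment> \<open>Openness in the quotient is tested on the preimage in the disjoint union, hence
    separately on each summand \<open>X j\<close>.\<close>
  have "openin (X j) {y. (j, y) \<in> {p \<in> topspace (sum_topology X I). ?q p \<in> ?W}}"
    if j: "j \<in> I" for j
  proof -
    have "continuous_map (subtopology (X j) (A j i)) (X i) (f j i)"
      using sys[unfolded adjunction_system_def, THEN conjunct2, THEN conjunct1] i j by blast
    \<comment> \<open>Continuity gives openness only relative to \<open>A j i\<close>; it passes to
      \<open>X j\<close> because \<open>A j i\<close> is open there.\<close>
    then have "openin (X j) {y \<in> topspace (subtopology (X j) (A j i)). f j i y \<in> W}"
      by (rule openin_trans_full[OF openin_continuous_map_preimage[OF _ W] opn[OF j i]])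
    moreover have "{y. (j, y) \<in> {p \<in> topspace (sum_topology X I). ?q p \<in> ?W}}
        = {y \<in> topspace (subtopology (X j) (A j i)). f j i y \<in> W}"
    proof -
      have "?q (j, y) \<in> ?W \<longleftrightarrow> y \<in> A j i \<and> f j i y \<in> W" if "y \<in> topspace (X j)" for y
      proof -
        have "?q (j, y) \<in> ?W \<longleftrightarrow> (\<exists>x\<in>W. ?q (j, y) = ?q (i, x))"
          by (simp only: image_iff)
        \<comment> \<open>The only candidate for \<open>x\<close> is \<open>f j i y\<close>, so the
          quantifier collapses to \<open>f j i y \<in> W\<close>.\<close>
        also have "\<dots> \<longleftrightarrow> (\<exists>x\<in>W. y \<in> A j i \<and> f j i y = x)"
          using that sub by (intro bex_cong refl adjunction_class_eq_iff j i) auto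
        finally show ?thesis by simp
      qed
      then show ?thesis using j by auto
    qed
    ultimately show ?thesis by simp
  qed
  then have "openin (sum_topology X I) {p \<in> topspace (sum_topology X I). ?q p \<in> ?W}"
    unfolding openin_sum_topology by auto
  moreover have "?W \<subseteq> topspace (sum_topology X I) // adjunction_rel I A f"
    using sub i by (auto intro!: quotientI)
  ultimately show "openin (adjunction_space I X A f) ?W"
    by (simp add: adjunction_space_def openin_quotient_topology)
qed

end

theorem theorem2p1:
  fixes I :: "'i set"
    and M :: "'i \<Rightarrow> 'a topology"
    and A :: "'i \<Rightarrow> 'i \<Rightarrow> 'a set"
    and f :: "'i \<Rightarrow> 'i \<Rightarrow> 'a \<Rightarrow> 'a"
  assumes "countable I"
    and "adjunction_system I M A f"
    and "\<And>i. i \<in> I \<Longrightarrow> topological_manifold (M i)"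
    and "\<And>i. i \<in> I \<Longrightarrow> Hausdorff_space (M i)"
    and "\<And>i j. i \<in> I \<Longrightarrow> j \<in> I \<Longrightarrow> openin (M i) (A i j)"
  shows "locally_Euclidean_space (adjunction_space I M A f) \<and>
         second_countable_space (adjunction_space I M A f)"
proof
  \<comment> \<open>These facts instantiate \<open>g i\<close> in the transfer lemmas by the
    canonical map from \<open>M i\<close>.\<close>
  note cover = equalityD1[OF topspace_adjunction_space[OF assms(2)]]
  note cont = continuous_map_adjunction_space[OF assms(2)]
  note opn = open_map_adjunction_space[OF assms(2,5)]
  show "locally_Euclidean_space (adjunction_space I M A f)"
    using locally_Euclidean_space_open_embeddings[OF cover opn cont inj_on_adjunction_space[OF assms(2)]] assms(3)
    by (simp add: topological_manifold_def)
  show "second_countable_space (adjunction_space I M A f)"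
    using second_countable_space_open_maps[OF assms(1) cover opn cont] assms(3)
    by (simp add: topological_manifold_def)
qed

end
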